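(* Consider the TR1NE algorithm with noisy function and gradient values, let $B$ be as in the context and $$\bar B=\frac{B}{\nu\min\{1,R_k\}} .$$ Then, for each iteration $k$ of the TR1NE algorithm, $$\mathbb{P}{\rm r}\Big[\mathcal{M}_k\;\Big|\;\mathcal{A}_{k-1},\ \{\|\nabla_x^1f(X_k)\|\ge2\bar B\}\Big]\ge\alpha_* .$$ Moreover, if $\omega$ is a realization for which $\mathbb{P}{\rm r}[\mathcal{M}_k\mid\mathcal{A}_{k-1}](\omega)<\alpha_*$, then $$\|\nabla_x^1f(x_k)\|<2\bar B(\omega).$$
   Context: $f:\mathbb{R}^n\to\mathbb{R}$ is continuously differentiable, with gradient $\nabla_x^1f$; $\|\cdot\|$ is the Euclidean norm. Values of $f$ and $\nabla_x^1f$ can only be computed subject to random noise; estimates are denoted $\overline{f}$, $\overline{\nabla_x^1f}$. The TR1NE algorithm. Step 0. Given: starting point $x_0$, $r_{\max}>0$, $\epsilon\in(0,1)$, initial radius $r_0\in(\epsilon,r_{\max}]$, $\eta\in(0,1)$, $\gamma>1$; $\nu=\min[\frac12\eta,\frac14(1-\eta)]$. Set $k=0$. Step 1. Compute the estimate $\overline{\nabla_x^1f}(x_k)$. Step 2. Set $s_k=-\frac{\overline{\nabla_x^1f}(x_k)}{\|\overline{\nabla_x^1f}(x_k)\|}r_k$. Step 3. Compute an estimate $\overline{f}(x_k)-\overline{f}(x_k+s_k)$ of $f(x_k)-f(x_k+s_k)$. Step 4. Compute $\rho_k=\frac{\overline{f}(x_k)-\overline{f}(x_k+s_k)}{\|\overline{\nabla_x^1f}(x_k)\|r_k}$.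 If $\rho_k\ge\eta$ set $x_{k+1}=x_k+s_k$; otherwise set $x_{k+1}=x_k$. Step 5. Set $r_{k+1}=r_k/\gamma$ if $\rho_k<\eta$ and $r_{k+1}=\min[r_{\max},\gamma r_k]$ if $\rho_k\ge\eta$. Increase $k$ by one and go to Step 1. Because of noise the algorithm generates a random process; uppercase $X_k,R_k,S_k$ are the random variables with realizations $x_k,r_k,s_k$. $F(X_k),F(X_k+S_k)$ are the random function estimates, $\Delta f(X_k,S_k)=f(X_k)-f(X_k+S_k)$, $\Delta F(X_k,S_k)=F(X_k)-F(X_k+S_k)$. $\mathcal{A}_{k-1}$ is the $\sigma$-algebra generated by all gradient and function estimates of iterations $0,\ldots,k-1$ ($\mathcal{A}_{-1}=\sigma(x_0)$). For an event $\mathcal{G}$, conditioning on "$\mathcal{A}_{k-1},\mathcal{G}$" means conditioning with respect to the trace $\sigma$-algebra of $\mathcal{A}_{k-1}$ on $\mathcal{G}$. Event: $\mathcal{M}_k=\{\,|\,\|\nabla_x^1f(X_k)\|-\|\overline{\nabla_x^1f}(X_k)\|\,|\le\nu\|\overline{\nabla_x^1f}(X_k)\|\,\}$. Assumption on error distributions. At iteration $k$, $H_{0,k},H_{1,k}$ are continuous and increasing random functions from $\mathbb{R}_+$ to $[0,1]$, measurable for $\mathcal{A}_{k-1}$, with $H_{0,k}(0)=H_{1,k}(0)=0$, $\lim_{\tau\to\infty}H_{0,k}(\tau)=\lim_{\tau\to\infty}H_{1,k}(\tau)=1$, and $\mathbb{P}{\rm r}[|\Delta F(X_k,S_k)-\Delta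 f(X_k,S_k)|<\tau\mid\mathcal{A}_{k-1}]\ge H_{0,k}(\tau)$, $\ \mathbb{P}{\rm r}[\|\nabla_x^1f(X_k)-\overline{\nabla_x^1f}(X_k)\|<\tau\mid\mathcal{A}_{k-1}]\ge H_{1,k}(\tau)$. $\alpha_*\in[\sqrt{1/2},1]$ is a constant (the common value of the lower thresholds on the conditional probabilities of accurate models and of accurate function estimates), $B_0,B_1$ are such that $H_{0,k}(B_0)=\sqrt{\alpha_*}$ and $H_{1,k}(B_1)=\sqrt{\alpha_*}$, and $B=\max[B_0,B_1]$. *)

theory Defs
  imports "HOL-Probability.Probability"
begin

text \<open>
  One realization of TR1NE: \<open>g k\<close> is the gradient estimate of iteration \<open>k\<close>, and \<open>fx k\<close>, \<open>fs k\<close> are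
  the function estimates computed at that iteration at \<open>x k\<close> and at \<open>x k + s k\<close> (the function is
  estimated afresh at every iteration). The recursion determines \<open>x\<close>, \<open>s\<close>, \<open>r\<close> from the estimates.
  If \<open>g k = 0\<close>, where the step is mathematically undefined, \<open>x / 0 = 0\<close> makes the step zero and the
  iteration unsuccessful.
\<close>

definition tr1ne_rho ::
    "(nat \<Rightarrow> real) \<Rightarrow> (nat \<Rightarrow> 'a::euclidean_space) \<Rightarrow> (nat \<Rightarrow> real) \<Rightarrow> (nat \<Rightarrow> real) \<Rightarrow> nat \<Rightarrow> real" where
  "tr1ne_rho r g fx fs k = (fx k - fs k) / (norm (g k) * r k)"

definition tr1ne_run ::
    "'a::euclidean_space \<Rightarrow> real \<Rightarrow> real \<Rightarrow> real \<Rightarrow> real \<Rightarrow>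
     (nat \<Rightarrow> 'a) \<Rightarrow> (nat \<Rightarrow> 'a) \<Rightarrow> (nat \<Rightarrow> real) \<Rightarrow>
     (nat \<Rightarrow> 'a) \<Rightarrow> (nat \<Rightarrow> real) \<Rightarrow> (nat \<Rightarrow> real) \<Rightarrow> bool" where
  "tr1ne_run x0 r0 rmax \<eta> \<gamma> x s r g fx fs \<longleftrightarrow>
     x 0 = x0 \<and> r 0 = r0 \<and>
     (\<forall>k. s k = - (r k / norm (g k)) *\<^sub>R g k \<and>
          x (Suc k) = (if tr1ne_rho r g fx fs k \<ge> \<eta> then x k + s k else x k) \<and>
          r (Suc k) = (if tr1ne_rho r g fx fs k \<ge> \<eta> then min rmax (\<gamma> * r k) else r k / \<gamma>))"

definition tr1ne_nu :: "real \<Rightarrow> real" where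
  "tr1ne_nu \<eta> = min (1/2 * \<eta>) (1/4 * (1 - \<eta>))"

text \<open>
  The index is shifted: \<open>past_algebra M G FX FS k\<close> is \<open>\<A>\<close> with index \<open>k - 1\<close>, generated by the
  estimates of iterations \<open>0, \<dots>, k - 1\<close>. For \<open>k = 0\<close> it is trivial, i.e. equal to the
  \<open>\<sigma>\<close>-algebra generated by the deterministic starting point.
\<close>

definition past_algebra ::
    "'w measure \<Rightarrow> (nat \<Rightarrow> 'w \<Rightarrow> 'a::euclidean_space) \<Rightarrow> (nat \<Rightarrow> 'w \<Rightarrow> real) \<Rightarrow> (nat \<Rightarrow> 'w \<Rightarrow> real) \<Rightarrow>
     nat \<Rightarrow> 'w measure" where
  "past_algebra M G FX FS k = sigma (space M)
     (\<Union>j\<in>{..<k}. {G j -` C \<inter> space M | C. C \<in> sets borel} \<union>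
                  {FX j -` C \<inter> space M | C. C \<in> sets borel} \<union>
                  {FS j -` C \<inter> space M | C. C \<in> sets borel})"

definition cond_pr :: "'w measure \<Rightarrow> 'w measure \<Rightarrow> 'w set \<Rightarrow> 'w \<Rightarrow> real" where
  "cond_pr M A E = real_cond_exp M A (indicator E)"

text \<open>
  Conditioning on \<open>A\<close> and an event \<open>G\<close>: all of it takes place on \<open>G\<close>, with the trace \<open>\<sigma>\<close>-algebra of
  \<open>A\<close> on \<open>G\<close>. Dividing the restricted measure by the probability of \<open>G\<close> would not change the
  conditional expectation.
\<close>

definition cond_pr_trace :: "'w measure \<Rightarrow> 'w measure \<Rightarrow> 'w set \<Rightarrow> 'w set \<Rightarrow> 'w \<Rightarrow> real" where
  "cond_pr_trace M A G E = cond_pr (restrict_space M G) (restrict_space A G) E"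

text \<open>
  \<open>H \<omega>\<close> is only relevant on the nonnegative reals. \<open>increasing\<close> is read in the weak sense, so that
  \<open>H \<omega>\<close> may reach the value 1 (bounded noise).
\<close>

definition random_error_bound :: "'w measure \<Rightarrow> ('w \<Rightarrow> real \<Rightarrow> real) \<Rightarrow> bool" where
  "random_error_bound A H \<longleftrightarrow>
     (\<forall>\<tau>\<ge>0. (\<lambda>\<omega>. H \<omega> \<tau>) \<in> borel_measurable A) \<and>
     (\<forall>\<omega>\<in>space A. continuous_on {0..} (H \<omega>) \<and> mono_on {0..} (H \<omega>) \<and>
        (\<forall>\<tau>\<ge>0. 0 \<le> H \<omega> \<tau> \<and> H \<omega> \<tau> \<le> 1) \<and>
        H \<omega> 0 = 0 \<and> (H \<omega> \<longlongrightarrow> 1) at_top)"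

text \<open>
  \<open>b\<close> selects a level-\<open>p\<close> point of \<open>H\<close>. The measurability clause only matters where \<open>H \<omega>\<close> is flat at
  level \<open>p\<close>, so that \<open>b \<omega>\<close> is not unique: it excludes selections that depend on the future. For
  strictly increasing \<open>H \<omega>\<close> it is automatic (\<open>error_levelI_strict\<close>).
\<close>

definition error_level :: "'w measure \<Rightarrow> ('w \<Rightarrow> real \<Rightarrow> real) \<Rightarrow> real \<Rightarrow> ('w \<Rightarrow> real) \<Rightarrow> bool" where
  "error_level A H p b \<longleftrightarrow>
     b \<in> borel_measurable A \<and> (\<forall>\<omega>\<in>space A. 0 \<le> b \<omega> \<and> H \<omega> (b \<omega>) = p)"

lemma error_levelI_strict:
  assumes H: "random_error_bound A H"
    and strict: "\<And>\<omega>. \<omega> \<in> space A \<Longrightarrow> strict_mono_on {0..} (H \<omega>)"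
    and b: "\<And>\<omega>. \<omega> \<in> space A \<Longrightarrow> 0 \<le> b \<omega> \<and> H \<omega> (b \<omega>) = p"
  shows "error_level A H p b"
proof -
  have "{\<omega> \<in> space A. b \<omega> \<le> t} \<in> sets A" for t
  proof (cases "t \<ge> 0")
    case True
    have "{\<omega> \<in> space A. b \<omega> \<le> t} = {\<omega> \<in> space A. p \<le> H \<omega> t}"
      using strict_mono_on_less_eq[OF strict] b True by (auto simp: atLeast_def)
    moreover have "(\<lambda>\<omega>. H \<omega> t) \<in> borel_measurable A"
      using H True by (simp add: random_error_bound_def)
    ultimately show ?thesis by simp
  next
    case False
    then have "{\<omega> \<in> space A. b \<omega> \<le> t} = {}" using b by fastforce
    then show ?thesis by (metis sets.empty_sets)
  qed
  then have "b \<in> borel_measurable A" by (simp add: borel_measurable_iff_le)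
  then show ?thesis using b by (simp add: error_level_def)
qed

definition tr1ne_Bbar :: "real \<Rightarrow> real \<Rightarrow> real \<Rightarrow> real" where
  "tr1ne_Bbar \<nu> B r = B / (\<nu> * min 1 r)"

definition model_event ::
    "'w measure \<Rightarrow> real \<Rightarrow> ('a::euclidean_space \<Rightarrow> 'a) \<Rightarrow> ('w \<Rightarrow> 'a) \<Rightarrow> ('w \<Rightarrow> 'a) \<Rightarrow> 'w set" where
  "model_event M \<nu> grad X G =
     {\<omega> \<in> space M. \<bar>norm (grad (X \<omega>)) - norm (G \<omega>)\<bar> \<le> \<nu> * norm (G \<omega>)}"

end

theory Submission
  imports Defs
begin

text \<open>
  Everything that the past determines may be treated as a constant under the conditional
  expectation, and \<open>X k\<close>, \<open>R k\<close>, \<open>B0 k\<close>, \<open>B1 k\<close>, hence also the event \<open>E\<close> that the true gradient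
  has norm at least \<open>2 * Bbar k\<close>, are determined by the past (\<open>tr1ne_adapted\<close>). On \<open>E\<close> the noise
  level \<open>B1 k\<close> is small relative to the true gradient, so by the triangle inequality a gradient
  error below \<open>B1 k\<close> forces the relative accuracy required by the model event
  (\<open>relative_accuracy_if_gradient_large\<close>). Conditionally on the past, such an error has
  probability at least \<open>sqrt \<alpha>\<close>, and \<open>sqrt \<alpha> \<ge> \<alpha>\<close> since \<open>\<alpha> \<le> 1\<close>. Therefore the conditional
  probability of the model event is at least \<open>\<alpha>\<close> almost everywhere on \<open>E\<close>. The second claim is the
  contrapositive of this, and the first one restates it, because conditioning on the trace of the
  past on \<open>E\<close> agrees with conditioning on the past as long as \<open>E\<close> itself belongs to the past
  (\<open>cond_pr_trace_eq\<close>).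

  The probabilistic point that needs care is that the error bound is assumed for each deterministic
  threshold separately, with an exceptional null set depending on the threshold, whereas
  \<open>B1 k\<close> is random. Lemma \<open>cond_pr_random_threshold\<close> bridges the gap: rational thresholds
  below the random one are only countably many, and continuity of the bound recovers the
  threshold itself.
\<close>

section \<open>Conditional probabilities\<close>

text \<open>
  Localization: an inclusion that holds only inside a set of the conditioning \<open>\<sigma>\<close>-algebra
  still yields monotonicity there, since the indicator of that set factors out of the conditional
  expectation.
\<close>

lemma (in finite_measure_subalgebra) cond_pr_mono_on:
  assumes C: "C \<in> sets F" and D: "D \<in> sets M" and E: "E \<in> sets M"
    and sub: "C \<inter> D \<subseteq> E"
  shows "AE \<omega> in M. \<omega> \<in> C \<longrightarrow> cond_pr M F D \<omega> \<le> cond_pr M F E \<omega>"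
proof -
  have [measurable]: "C \<in> sets M" "D \<in> sets M" "E \<in> sets M"
    using C D E subalg by (auto simp: subalgebra_def)
  have [measurable]: "C \<in> sets F" by (rule C)
  have int: "integrable M (\<lambda>\<omega>. indicator C \<omega> * indicator U \<omega> :: real)" if [measurable]: "U \<in> sets M" for U
    by (rule integrable_const_bound[where B=1]) (auto simp: indicator_def)
  have factor: "AE \<omega> in M. real_cond_exp M F (\<lambda>\<omega>. indicator C \<omega> * indicator U \<omega>) \<omega>
      = indicator C \<omega> * cond_pr M F U \<omega>" if [measurable]: "U \<in> sets M" for U
    unfolding cond_pr_def by (rule real_cond_exp_mult) (use int[of U] in auto)
  have "AE \<omega> in M. real_cond_exp M F (\<lambda>\<omega>. indicator C \<omega> * indicator D \<omega>) \<omega>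
      \<le> real_cond_exp M F (\<lambda>\<omega>. indicator C \<omega> * indicator E \<omega>) \<omega>"
    by (rule real_cond_exp_mono) (use sub int D E in \<open>auto simp: indicator_def\<close>)
  then show ?thesis
    using factor[OF D] factor[OF E] by eventually_elim (auto simp: indicator_def)
qed

text \<open>
  A set of the trace \<open>\<sigma>\<close>-algebra on \<open>C\<close> is a set of the whole \<open>\<sigma>\<close>-algebra when \<open>C\<close> is one, so the
  restriction to \<open>C\<close> of the conditional probability has the defining averages of the
  conditional probability given the trace.
\<close>

lemma (in finite_measure_subalgebra) cond_pr_trace_eq:
  assumes C: "C \<in> sets F" and D: "D \<in> sets M"
  shows "AE \<omega> in restrict_space M C. cond_pr_trace M F C D \<omega> = cond_pr M F D \<omega>"
proof -
  have CM[measurable]: "C \<in> sets M" and [measurable]: "D \<in> sets M"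
    using C D subalg by (auto simp: subalgebra_def)
  have CM': "C \<inter> space M \<in> sets M" and CF': "C \<inter> space F \<in> sets F"
    using CM C by auto
  interpret T: finite_measure_subalgebra "restrict_space M C" "restrict_space F C"
  proof (intro finite_measure_subalgebra.intro finite_measure_subalgebra_axioms.intro)
    show "finite_measure (restrict_space M C)"
      by (rule finite_measure_restrict_space[OF finite_measure_axioms CM])
    show "subalgebra (restrict_space M C) (restrict_space F C)"
      using subalg sets_restrict_space_iff[OF CM'] sets_restrict_space_iff[OF CF']
      by (auto simp: subalgebra_def space_restrict_space)
  qed
  have intD: "integrable M (indicator D :: _ \<Rightarrow> real)"
    by (rule integrable_const_bound[where B=1]) (auto simp: indicator_def)
  note intc = real_cond_exp_int(1)[OF intD]
  show ?thesis unfolding cond_pr_trace_def cond_pr_def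
  proof (rule T.real_cond_exp_charact)
    fix A assume "A \<in> sets (restrict_space F C)"
    then have A: "A \<subseteq> C" "A \<in> sets F"
      using sets_restrict_space_iff[OF CF'] by auto
    have on_C: "(\<integral>\<omega>\<in>A. u \<omega> \<partial>restrict_space M C) = (\<integral>\<omega>\<in>A. u \<omega> \<partial>M)" for u :: "'a \<Rightarrow> real"
      unfolding set_integral_restrict_space[OF CM'] unfolding set_lebesgue_integral_def
      using A(1) by (intro Bochner_Integration.integral_cong) (auto simp: indicator_def)
    show "(\<integral>\<omega>\<in>A. indicator D \<omega> \<partial>restrict_space M C)
        = (\<integral>\<omega>\<in>A. real_cond_exp M F (indicator D) \<omega> \<partial>restrict_space M C)"
      unfolding on_C by (rule real_cond_exp_intA[OF intD A(2)])
  next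
    show "integrable (restrict_space M C) (indicator D :: _ \<Rightarrow> real)"
      unfolding integrable_restrict_space[OF CM'] by (rule integrable_mult_indicator[OF CM intD])
    show "integrable (restrict_space M C) (real_cond_exp M F (indicator D))"
      unfolding integrable_restrict_space[OF CM'] by (rule integrable_mult_indicator[OF CM intc])
    show "real_cond_exp M F (indicator D) \<in> borel_measurable (restrict_space F C)"
      by (rule measurable_restrict_space1) simp
  qed
qed

text \<open>
  For a rational \<open>q\<close>, the event \<open>Z < q\<close> is contained in \<open>Z < b\<close> wherever \<open>q \<le> b\<close>, and the latter
  set is in the conditioning \<open>\<sigma>\<close>-algebra. Off one null set the conditional probability of
  \<open>Z < b\<close> thus dominates \<open>H\<close> at every rational in \<open>[0, b]\<close>, and so at \<open>b\<close>, by left continuity.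
\<close>

lemma (in finite_measure_subalgebra) cond_pr_random_threshold:
  fixes Z b :: "'a \<Rightarrow> real"
  assumes Z[measurable]: "Z \<in> borel_measurable M"
    and b[measurable]: "b \<in> borel_measurable F"
    and b0: "\<And>\<omega>. \<omega> \<in> space M \<Longrightarrow> 0 \<le> b \<omega>"
    and cont: "\<And>\<omega>. \<omega> \<in> space M \<Longrightarrow> continuous_on {0..} (H \<omega>)"
    and bound: "\<And>\<tau>. 0 \<le> \<tau> \<Longrightarrow>
      AE \<omega> in M. H \<omega> \<tau> \<le> cond_pr M F {\<omega> \<in> space M. Z \<omega> < \<tau>} \<omega>"
  shows "AE \<omega> in M. H \<omega> (b \<omega>) \<le> cond_pr M F {\<omega> \<in> space M. Z \<omega> < b \<omega>} \<omega>"
proof -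
  let ?P = "cond_pr M F {\<omega> \<in> space M. Z \<omega> < b \<omega>}"
  have [measurable]: "b \<in> borel_measurable M"
    by (rule measurable_from_subalg[OF subalg b])
  have sp: "space F = space M" using subalg by (simp add: subalgebra_def)
  have "AE \<omega> in M. 0 \<le> real_of_rat q \<longrightarrow> real_of_rat q \<le> b \<omega> \<longrightarrow> H \<omega> (real_of_rat q) \<le> ?P \<omega>" for q
  proof (cases "0 \<le> real_of_rat q")
    case True
    have "{\<omega> \<in> space F. real_of_rat q \<le> b \<omega>} \<in> sets F" by measurable
    then have "{\<omega> \<in> space M. real_of_rat q \<le> b \<omega>} \<in> sets F" by (simp add: sp)
    then have "AE \<omega> in M. \<omega> \<in> {\<omega> \<in> space M. real_of_rat q \<le> b \<omega>} \<longrightarrow>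
        cond_pr M F {\<omega> \<in> space M. Z \<omega> < real_of_rat q} \<omega> \<le> ?P \<omega>"
      by (rule cond_pr_mono_on) auto
    then show ?thesis
      using bound[OF True] AE_space[of M] by eventually_elim auto
  qed simp
  then have "AE \<omega> in M. \<forall>q. 0 \<le> real_of_rat q \<longrightarrow> real_of_rat q \<le> b \<omega> \<longrightarrow> H \<omega> (real_of_rat q) \<le> ?P \<omega>"
    by (simp add: AE_all_countable)
  then show ?thesis
    using AE_space[of M]
  proof eventually_elim
    case (elim \<omega>)
    show ?case
    proof (cases "b \<omega> = 0")
      case True
      then show ?thesis using elim(1)[rule_format, of 0] by simp
    next
      case False
      then have pos: "0 < b \<omega>" using b0[OF elim(2)] by simp
      show ?thesis
      proof (rule ccontr)
        assume "\<not> H \<omega> (b \<omega>) \<le> ?P \<omega>"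
        then have "0 < H \<omega> (b \<omega>) - ?P \<omega>" by simp
        moreover have "b \<omega> \<in> {0..}" using pos by simp
        ultimately obtain d where d: "0 < d"
          "\<forall>t\<in>{0..}. dist t (b \<omega>) < d \<longrightarrow> dist (H \<omega> t) (H \<omega> (b \<omega>)) < H \<omega> (b \<omega>) - ?P \<omega>"
          using cont[OF elim(2)] unfolding continuous_on_iff by blast
        have "max 0 (b \<omega> - d) < b \<omega>" using pos d(1) by simp
        then obtain q where q: "max 0 (b \<omega> - d) < real_of_rat q" "real_of_rat q < b \<omega>"
          using of_rat_dense by blast
        then have "dist (H \<omega> (real_of_rat q)) (H \<omega> (b \<omega>)) < H \<omega> (b \<omega>) - ?P \<omega>"
          by (intro d(2)[rule_format]) (auto simp: dist_real_def)
        moreover have "H \<omega> (real_of_rat q) \<le> ?P \<omega>"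
          using elim(1) q by auto
        ultimately show False by (auto simp: dist_real_def)
      qed
    qed
  qed
qed

section \<open>The past of the algorithm\<close>

lemma space_past_algebra [simp]: "space (past_algebra M G FX FS k) = space M"
  unfolding past_algebra_def by (subst space_measure_of) auto

lemma sets_past_algebra:
  "sets (past_algebra M G FX FS k) = sigma_sets (space M)
     (\<Union>j\<in>{..<k}. {G j -` C \<inter> space M | C. C \<in> sets borel} \<union>
                  {FX j -` C \<inter> space M | C. C \<in> sets borel} \<union>
                  {FS j -` C \<inter> space M | C. C \<in> sets borel})"
  unfolding past_algebra_def by (subst sets_measure_of) auto

lemma subalgebra_past_algebra:
  assumes "\<And>j. G j \<in> borel_measurable M" "\<And>j. FX j \<in> borel_measurable M"
    "\<And>j. FS j \<in> borel_measurable M"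
  shows "subalgebra M (past_algebra M G FX FS k)"
  unfolding subalgebra_def sets_past_algebra
  using assms by (auto intro!: sets.sigma_sets_subset dest: measurable_sets)

lemma subalgebra_past_algebra_Suc:
  "subalgebra (past_algebra M G FX FS (Suc k)) (past_algebra M G FX FS k)"
  unfolding subalgebra_def sets_past_algebra
  by (intro conjI sigma_sets_mono' UN_mono) auto

lemma measurable_past_algebra:
  assumes "j < k"
  shows "G j \<in> borel_measurable (past_algebra M G FX FS k)"
    and "FX j \<in> borel_measurable (past_algebra M G FX FS k)"
    and "FS j \<in> borel_measurable (past_algebra M G FX FS k)"
proof -
  have gen: "U \<in> sets (past_algebra M G FX FS k)"
    if "U \<in> {G j -` C \<inter> space M | C. C \<in> sets borel} \<union>
      {FX j -` C \<inter> space M | C. C \<in> sets borel} \<union>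
      {FS j -` C \<inter> space M | C. C \<in> sets borel}" for U
    unfolding sets_past_algebra
    by (rule sigma_sets.Basic, rule UN_I[where a=j], simp add: assms, rule that)
  show "G j \<in> borel_measurable (past_algebra M G FX FS k)"
    "FX j \<in> borel_measurable (past_algebra M G FX FS k)"
    "FS j \<in> borel_measurable (past_algebra M G FX FS k)"
    by (rule measurableI, simp, simp only: space_past_algebra, rule gen, blast)+
qed

text \<open>
  The update that produces \<open>X (Suc k)\<close> and \<open>R (Suc k)\<close> reads, besides \<open>X k\<close> and \<open>R k\<close>, only the
  estimates of iteration \<open>k\<close>, which already belong to \<open>past_algebra M G FX FS (Suc k)\<close>.
\<close>

lemma tr1ne_adapted:
  assumes run: "\<And>\<omega>. \<omega> \<in> space M \<Longrightarrow>
    tr1ne_run x0 r0 rmax \<eta> \<gamma> (\<lambda>j. X j \<omega>) (\<lambda>j. S j \<omega>) (\<lambda>j. R j \<omega>)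
      (\<lambda>j. G j \<omega>) (\<lambda>j. FX j \<omega>) (\<lambda>j. FS j \<omega>)"
  shows "X k \<in> borel_measurable (past_algebra M G FX FS k) \<and>
    R k \<in> borel_measurable (past_algebra M G FX FS k)"
proof (induction k)
  case 0
  have "X 0 \<omega> = x0" "R 0 \<omega> = r0" if "\<omega> \<in> space M" for \<omega>
    using run[OF that] by (auto simp: tr1ne_run_def)
  note start = this
  have "X 0 \<in> borel_measurable (past_algebra M G FX FS 0) \<longleftrightarrow>
      (\<lambda>_. x0) \<in> borel_measurable (past_algebra M G FX FS 0)"
    by (rule measurable_cong) (simp add: start)
  moreover have "R 0 \<in> borel_measurable (past_algebra M G FX FS 0) \<longleftrightarrow>
      (\<lambda>_. r0) \<in> borel_measurable (past_algebra M G FX FS 0)"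
    by (rule measurable_cong) (simp add: start)
  ultimately show ?case by simp
next
  case (Suc k)
  let ?A = "past_algebra M G FX FS (Suc k)"
  have [measurable]: "X k \<in> borel_measurable ?A" "R k \<in> borel_measurable ?A"
    using Suc measurable_from_subalg[OF subalgebra_past_algebra_Suc] by blast+
  have [measurable]: "G k \<in> borel_measurable ?A" "FX k \<in> borel_measurable ?A"
    "FS k \<in> borel_measurable ?A"
    by (rule measurable_past_algebra; simp)+
  let ?rho = "\<lambda>\<omega>. (FX k \<omega> - FS k \<omega>) / (norm (G k \<omega>) * R k \<omega>)"
  have "X (Suc k) \<omega> = (if ?rho \<omega> \<ge> \<eta> then X k \<omega> + (- (R k \<omega> / norm (G k \<omega>))) *\<^sub>R G k \<omega> else X k \<omega>)"
    and "R (Suc k) \<omega> = (if ?rho \<omega> \<ge> \<eta> then min rmax (\<gamma> * R k \<omega>) else R k \<omega> / \<gamma>)"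
    if "\<omega> \<in> space ?A" for \<omega>
    using run[of \<omega>] that by (auto simp: tr1ne_run_def tr1ne_rho_def)
  note step = this
  have "X (Suc k) \<in> borel_measurable ?A" by (subst measurable_cong[OF step(1)]) auto
  moreover have "R (Suc k) \<in> borel_measurable ?A" by (subst measurable_cong[OF step(2)]) auto
  ultimately show ?case by simp
qed

lemma tr1ne_radius_pos:
  assumes "tr1ne_run x0 r0 rmax \<eta> \<gamma> x s r g fx fs" "0 < r0" "0 < rmax" "1 < \<gamma>"
  shows "0 < r k"
  using assms by (induction k) (auto simp: tr1ne_run_def)

section \<open>Accuracy of the model for large gradients\<close>

text \<open>
  The factor \<open>2\<close> in the lower bound on \<open>norm g\<close> is what makes the estimate \<open>h\<close> long enough:
  \<open>norm h \<ge> norm g - B \<ge> 2 * B / \<nu> - B\<close>, hence \<open>\<nu> * norm h \<ge> (2 - \<nu>) * B \<ge> B\<close>.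
\<close>

lemma relative_accuracy_if_gradient_large:
  fixes g h :: "'a::real_normed_vector"
  assumes \<nu>: "0 < \<nu>" "\<nu> \<le> 1" and r: "0 < r"
    and err: "norm (g - h) \<le> B"
    and large: "2 * tr1ne_Bbar \<nu> B r \<le> norm g"
  shows "\<bar>norm g - norm h\<bar> \<le> \<nu> * norm h"
proof -
  have B: "0 \<le> B" using err norm_ge_zero order_trans by blast
  have diff: "\<bar>norm g - norm h\<bar> \<le> B"
    using norm_triangle_ineq3[of g h] err by linarith
  have "\<nu> * min 1 r \<le> \<nu>" "0 < \<nu> * min 1 r"
    using \<nu> r by (auto simp: mult_le_cancel_left1)
  then have "B / \<nu> \<le> tr1ne_Bbar \<nu> B r"
    unfolding tr1ne_Bbar_def using B \<nu> by (intro divide_left_mono) auto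
  then have "2 * (B / \<nu>) - B \<le> norm h" using large diff by linarith
  then have "\<nu> * (2 * (B / \<nu>) - B) \<le> \<nu> * norm h" using \<nu> by (intro mult_left_mono) auto
  moreover have "\<nu> * (2 * (B / \<nu>) - B) = 2 * B - \<nu> * B"
    using \<nu> by (simp add: field_simps)
  moreover have "\<nu> * B \<le> B" using B \<nu> by (simp add: mult_left_le_one_le)
  ultimately show ?thesis using diff by linarith
qed

section \<open>Probability of accurate models\<close>

theorem theorem4p2:
  fixes M :: "'w measure"
    and f :: "real ^ 'n \<Rightarrow> real"
    and grad :: "real ^ 'n \<Rightarrow> real ^ 'n"
    and x0 :: "real ^ 'n"
    and \<epsilon> r0 rmax \<eta> \<gamma> \<alpha> :: real
    and X S G :: "nat \<Rightarrow> 'w \<Rightarrow> real ^ 'n"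
    and R FX FS :: "nat \<Rightarrow> 'w \<Rightarrow> real"
    and H0 H1 :: "nat \<Rightarrow> 'w \<Rightarrow> real \<Rightarrow> real"
    and B0 B1 :: "nat \<Rightarrow> 'w \<Rightarrow> real"
    and k :: nat
  defines "\<A> \<equiv> past_algebra M G FX FS"
    and "\<M> \<equiv> \<lambda>k. model_event M (tr1ne_nu \<eta>) grad (X k) (G k)"
    and "Bbar \<equiv> \<lambda>k \<omega>. tr1ne_Bbar (tr1ne_nu \<eta>) (max (B0 k \<omega>) (B1 k \<omega>)) (R k \<omega>)"
  assumes "prob_space M"
    and "\<And>x. GDERIV f x :> grad x"
    and "continuous_on UNIV grad"
    and "0 < \<epsilon>" "\<epsilon> < 1" "0 < rmax" "\<epsilon> < r0" "r0 \<le> rmax" "0 < \<eta>" "\<eta> < 1" "1 < \<gamma>"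
    and "\<And>j. G j \<in> borel_measurable M"
    and "\<And>j. FX j \<in> borel_measurable M"
    and "\<And>j. FS j \<in> borel_measurable M"
    and "\<And>\<omega>. \<omega> \<in> space M \<Longrightarrow>
           tr1ne_run x0 r0 rmax \<eta> \<gamma> (\<lambda>j. X j \<omega>) (\<lambda>j. S j \<omega>) (\<lambda>j. R j \<omega>)
             (\<lambda>j. G j \<omega>) (\<lambda>j. FX j \<omega>) (\<lambda>j. FS j \<omega>)"
    and "sqrt (1/2) \<le> \<alpha>" "\<alpha> \<le> 1"
    and "\<And>j. random_error_bound (\<A> j) (H0 j)"
    and "\<And>j. random_error_bound (\<A> j) (H1 j)"
    and "\<And>j \<tau>. 0 \<le> \<tau> \<Longrightarrow> AE \<omega> in M. H0 j \<omega> \<tau> \<le>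
           cond_pr M (\<A> j) {\<omega>' \<in> space M.
             \<bar>(FX j \<omega>' - FS j \<omega>') - (f (X j \<omega>') - f (X j \<omega>' + S j \<omega>'))\<bar> < \<tau>} \<omega>"
    and "\<And>j \<tau>. 0 \<le> \<tau> \<Longrightarrow> AE \<omega> in M. H1 j \<omega> \<tau> \<le>
           cond_pr M (\<A> j) {\<omega>' \<in> space M. norm (grad (X j \<omega>') - G j \<omega>') < \<tau>} \<omega>"
    and "\<And>j. error_level (\<A> j) (H0 j) (sqrt \<alpha>) (B0 j)"
    and "\<And>j. error_level (\<A> j) (H1 j) (sqrt \<alpha>) (B1 j)"
  shows "(let E = {\<omega> \<in> space M. norm (grad (X k \<omega>)) \<ge> 2 * Bbar k \<omega>} in
            AE \<omega> in restrict_space M E. cond_pr_trace M (\<A> k) E (\<M> k) \<omega> \<ge> \<alpha>) \<and>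
         (AE \<omega> in M. cond_pr M (\<A> k) (\<M> k) \<omega> < \<alpha> \<longrightarrow> norm (grad (X k \<omega>)) < 2 * Bbar k \<omega>)"
proof -
  interpret prob_space M by fact
  note G = assms(15) and FX = assms(16) and FS = assms(17) and run = assms(18)
  note H1 = assms(22) and bound1 = assms(24) and lev0 = assms(25) and lev1 = assms(26)
  interpret P: finite_measure_subalgebra M "\<A> k"
    unfolding \<A>_def using subalgebra_past_algebra[of G M FX FS, OF G FX FS]
    by unfold_locales
  have sp: "space (\<A> k) = space M" by (simp add: \<A>_def)
  define \<nu> where "\<nu> = tr1ne_nu \<eta>"
  have \<nu>: "0 < \<nu>" "\<nu> \<le> 1" using \<open>0 < \<eta>\<close> \<open>\<eta> < 1\<close> by (auto simp: \<nu>_def tr1ne_nu_def)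
  have R: "0 < R k \<omega>" if "\<omega> \<in> space M" for \<omega>
    using tr1ne_radius_pos[OF run[OF that], of k] \<open>0 < \<epsilon>\<close> \<open>\<epsilon> < r0\<close> \<open>0 < rmax\<close> \<open>1 < \<gamma>\<close> by simp
  have \<alpha>: "0 \<le> \<alpha>" "\<alpha> \<le> sqrt \<alpha>"
  proof -
    show "0 \<le> \<alpha>" using \<open>sqrt (1/2) \<le> \<alpha>\<close> real_sqrt_ge_zero[of "1/2"] by linarith
    then show "\<alpha> \<le> sqrt \<alpha>" using \<open>\<alpha> \<le> 1\<close>
      by (intro real_le_rsqrt) (simp add: power2_eq_square mult_left_le)
  qed
  have [measurable]: "X k \<in> borel_measurable (\<A> k)" "R k \<in> borel_measurable (\<A> k)"
    using tr1ne_adapted[of M, OF run] unfolding \<A>_def by auto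
  have [measurable]: "B0 k \<in> borel_measurable (\<A> k)" "B1 k \<in> borel_measurable (\<A> k)"
    using lev0 lev1 by (auto simp: error_level_def)
  have [measurable]: "grad \<in> borel_measurable borel"
    using \<open>continuous_on UNIV grad\<close> by (rule borel_measurable_continuous_onI)
  have [measurable]: "X k \<in> borel_measurable M" "B1 k \<in> borel_measurable M"
    by (rule measurable_from_subalg[OF P.subalg]; measurable)+
  have [measurable]: "G k \<in> borel_measurable M" by (rule G)

  define E where "E = {\<omega> \<in> space M. norm (grad (X k \<omega>)) \<ge> 2 * Bbar k \<omega>}"
  have "{\<omega> \<in> space (\<A> k). norm (grad (X k \<omega>)) \<ge> 2 * Bbar k \<omega>} \<in> sets (\<A> k)"
    unfolding Bbar_def tr1ne_Bbar_def by measurable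
  then have E: "E \<in> sets (\<A> k)" by (simp add: E_def sp)
  then have EM: "E \<in> sets M" using P.subalg by (auto simp: subalgebra_def)
  have model: "\<M> k \<in> sets M" unfolding \<M>_def model_event_def by measurable

  let ?acc = "{\<omega> \<in> space M. norm (grad (X k \<omega>) - G k \<omega>) < B1 k \<omega>}"
  have level: "AE \<omega> in M. H1 k \<omega> (B1 k \<omega>) \<le> cond_pr M (\<A> k) ?acc \<omega>"
    by (rule P.cond_pr_random_threshold)
      (use lev1[of k] H1[of k] bound1[of _ k] in
        \<open>auto simp: error_level_def random_error_bound_def sp\<close>)
  have "E \<inter> ?acc \<subseteq> \<M> k"
  proof
    fix \<omega> assume \<omega>: "\<omega> \<in> E \<inter> ?acc"
    then show "\<omega> \<in> \<M> k"
      using relative_accuracy_if_gradient_large[OF \<nu> R, of \<omega> "grad (X k \<omega>)" "G k \<omega>"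
          "max (B0 k \<omega>) (B1 k \<omega>)"]
      by (auto simp: \<M>_def model_event_def E_def Bbar_def \<nu>_def)
  qed
  then have "AE \<omega> in M. \<omega> \<in> E \<longrightarrow> cond_pr M (\<A> k) ?acc \<omega> \<le> cond_pr M (\<A> k) (\<M> k) \<omega>"
    by (intro P.cond_pr_mono_on E model) measurable
  then have key: "AE \<omega> in M. \<omega> \<in> E \<longrightarrow> \<alpha> \<le> cond_pr M (\<A> k) (\<M> k) \<omega>"
    using level AE_space[of M]
  proof eventually_elim
    case (elim \<omega>)
    have "H1 k \<omega> (B1 k \<omega>) = sqrt \<alpha>" using lev1[of k] elim(3) by (simp add: error_level_def sp)
    then show ?case using elim \<alpha> by linarith
  qed

  have "AE \<omega> in restrict_space M E. \<alpha> \<le> cond_pr M (\<A> k) (\<M> k) \<omega>"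
    using key EM by (subst AE_restrict_space_iff) auto
  then have "AE \<omega> in restrict_space M E. \<alpha> \<le> cond_pr_trace M (\<A> k) E (\<M> k) \<omega>"
    using P.cond_pr_trace_eq[OF E model] by eventually_elim simp
  moreover have "AE \<omega> in M. cond_pr M (\<A> k) (\<M> k) \<omega> < \<alpha> \<longrightarrow> norm (grad (X k \<omega>)) < 2 * Bbar k \<omega>"
    using key AE_space[of M] by eventually_elim (force simp: E_def)
  ultimately show ?thesis unfolding E_def Let_def by (rule conjI)
qed

end
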